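(* Let $\sigma$ be a feasible periodic schedule on one machine of the jobs $J_1,\ldots,J_n$, given by first starting times $s_i=u_i+v_iw$ (with $v_i$ a nonnegative integer and $0\le u_i<w$) such that $u_i+p_i\le w$ for every $i$. For every $i\in\{1,\ldots,n\}$ put $$x_i^\sigma=u_i,\qquad y_i^\sigma=h_i\cdot \mathrm{flip}(v_i,n_i,b).$$ Then placing, for each $i$, the rectangle $R_i$ with its lowest left corner at $(x_i^\sigma,y_i^\sigma)$ gives a feasible packing of $R_1,\ldots,R_n$ into the rectangle $\mathcal R$ of length $w$ and height $H$, and this packing satisfies $y_i^\sigma \bmod h_i=0$ for every $i$.
   Context: Jobs and periods. Let $w>0$ be a real number, $r\ge 1$, and let $b=(b_1,\ldots,b_r)$ be a vector of positive integers. Put $B_0=1$, $B_k=b_1 b_2\cdots b_k$ and $T_k=B_k w$ for $k=1,\ldots,r$ (so $T_1=b_1w$ and $T_k=b_kT_{k-1}$ for $k\ge 2$), and $H=B_r$. There are $n$ jobs $J_1,\ldots,J_n$; job $J_i$ has a processing time $p_i$ with $0<p_i\le w$ and a period $T_{n_i}=B_{n_i}w$, where $n_i\in\{1,\ldots,r\}$. Put $h_i=wH/T_{n_i}=H/B_{n_i}$, a positive integer. Schedules. A periodic schedule assigns to each job $J_i$ a starting time $s_i$ with $0\le s_i<T_{n_i}$ of its first occurrence; the occurrences of $J_i$ start at the times $s_i+kT_{n_i}$, $k\ge 0$, and each lasts $p_i$. Write $s_i=u_i+v_iw$ with $v_i$ an integer and $0\le u_i<w$; then $0\le v_i<B_{n_i}$.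 The schedule is feasible on one machine if for any two distinct jobs $J_i,J_j$ and all integers $0\le k<h_i$, $0\le k'<h_j$, one has $s_i+kT_{n_i}+p_i\le s_j+k'T_{n_j}$ or $s_j+k'T_{n_j}+p_j\le s_i+kT_{n_i}$. Flip. For any vector $c=(c_1,\ldots,c_r)$ of positive integers with $c_1\cdots c_r=H$, every integer $0\le y<H$ has a unique mixed radix decomposition $y=y_1+y_2c_1+y_3c_1c_2+\cdots+y_rc_1\cdots c_{r-1}$ with $0\le y_m<c_m$ for all $m$. For $1\le k\le r$, $\mathrm{flip}(y,k,c)$ is the integer obtained by reversing the first $k$ digits, read in the base vector $(c_k,c_{k-1},\ldots,c_1,c_{k+1},\ldots,c_r)$, i.e. $$\mathrm{flip}(y,k,c)=y_k+y_{k-1}c_k+y_{k-2}c_kc_{k-1}+\cdots+y_1(c_2\cdots c_k)+y_{k+1}(c_1\cdots c_k)+\cdots+y_r(c_1\cdots c_{r-1}).$$ Packing. $\mathcal R=[0,w]\times[0,H]$. For each job $J_i$, $R_i$ is a rectangle of length (horizontal side) $p_i$ and height (vertical side) $h_i$, not rotated. A packing assigns to each $R_i$ the coordinates $(x_i,y_i)$ of its lowest left corner, so that $R_i$ occupies $[x_i,x_i+p_i]\times[y_i,y_i+h_i]$. It is feasible if every $R_i$ is contained in $\mathcal R$ and no two distinct rectangles collide, where $R_i$ and $R_j$ collide if $x_i<x_j+p_j$, $x_j<x_i+p_i$, $y_i<y_j+h_j$ and $y_j<y_i+h_i$. *)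

theory Defs
  imports Complex_Main
begin

text \<open>
  Vectors \<open>(c\<^sub>1, \<dots>, c\<^sub>r)\<close> are functions on \<open>nat\<close> of which only the values at
  \<open>1, \<dots>, r\<close> matter; likewise jobs are indexed by \<open>{1..n}\<close>.
\<close>

definition radix_prod :: "(nat \<Rightarrow> nat) \<Rightarrow> nat \<Rightarrow> nat" where
  "radix_prod c k = (\<Prod>j=1..k. c j)"

definition period :: "real \<Rightarrow> (nat \<Rightarrow> nat) \<Rightarrow> nat \<Rightarrow> real" where
  "period w b k = real (radix_prod b k) * w"

text \<open>The division below is exact, see \<open>height_eq\<close>.\<close>

definition height :: "nat \<Rightarrow> (nat \<Rightarrow> nat) \<Rightarrow> nat \<Rightarrow> nat" where
  "height r b k = radix_prod b r div radix_prod b k"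

text \<open>
  The \<open>m\<close>-th mixed radix digit, \<open>m \<ge> 1\<close>, least significant digit first. Lemmas
  \<open>mixed_radix_decomposition\<close> and \<open>mixed_radix_unique\<close> show that these are the digits
  of the unique mixed radix decomposition.
\<close>

definition digit :: "(nat \<Rightarrow> nat) \<Rightarrow> nat \<Rightarrow> nat \<Rightarrow> nat" where
  "digit c y m = y div radix_prod c (m - 1) mod c m"

definition flip :: "nat \<Rightarrow> nat \<Rightarrow> nat \<Rightarrow> (nat \<Rightarrow> nat) \<Rightarrow> nat" where
  "flip r y k c =
     (\<Sum>m=1..k. digit c y m * (\<Prod>j=m+1..k. c j)) +
     (\<Sum>m=k+1..r. digit c y m * radix_prod c (m - 1))"

text \<open>
  In the following definitions \<open>p i\<close> is the processing time of job \<open>i\<close> and \<open>\<nu> i\<close> is the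
  index \<open>n\<^sub>i\<close> of its period; \<open>s i\<close> is the start of its first occurrence.
\<close>

definition periodic_schedule ::
  "real \<Rightarrow> (nat \<Rightarrow> nat) \<Rightarrow> nat \<Rightarrow> (nat \<Rightarrow> nat) \<Rightarrow> (nat \<Rightarrow> real) \<Rightarrow> bool" where
  "periodic_schedule w b n \<nu> s \<longleftrightarrow> (\<forall>i\<in>{1..n}. 0 \<le> s i \<and> s i < period w b (\<nu> i))"

definition feasible_schedule ::
  "real \<Rightarrow> nat \<Rightarrow> (nat \<Rightarrow> nat) \<Rightarrow> nat \<Rightarrow> (nat \<Rightarrow> real) \<Rightarrow> (nat \<Rightarrow> nat) \<Rightarrow> (nat \<Rightarrow> real) \<Rightarrow> bool" where
  "feasible_schedule w r b n p \<nu> s \<longleftrightarrow>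
     periodic_schedule w b n \<nu> s \<and>
     (\<forall>i\<in>{1..n}. \<forall>j\<in>{1..n}. i \<noteq> j \<longrightarrow>
        (\<forall>k<height r b (\<nu> i). \<forall>k'<height r b (\<nu> j).
           s i + real k * period w b (\<nu> i) + p i \<le> s j + real k' * period w b (\<nu> j) \<or>
           s j + real k' * period w b (\<nu> j) + p j \<le> s i + real k * period w b (\<nu> i)))"

text \<open>
  Packings of rectangles of length \<open>p i\<close> and height \<open>h i\<close>, with lowest left corner
  \<open>(x i, y i)\<close>, into \<open>[0, w] \<times> [0, H]\<close>.
\<close>

definition collide ::
  "(nat \<Rightarrow> real) \<Rightarrow> (nat \<Rightarrow> real) \<Rightarrow> (nat \<Rightarrow> real) \<Rightarrow> (nat \<Rightarrow> real) \<Rightarrow> nat \<Rightarrow> nat \<Rightarrow> bool" where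
  "collide p h x y i j \<longleftrightarrow>
     x i < x j + p j \<and> x j < x i + p i \<and> y i < y j + h j \<and> y j < y i + h i"

definition feasible_packing ::
  "real \<Rightarrow> real \<Rightarrow> nat \<Rightarrow> (nat \<Rightarrow> real) \<Rightarrow> (nat \<Rightarrow> real) \<Rightarrow> (nat \<Rightarrow> real) \<Rightarrow> (nat \<Rightarrow> real) \<Rightarrow> bool" where
  "feasible_packing w H n p h x y \<longleftrightarrow>
     (\<forall>i\<in>{1..n}. {x i..x i + p i} \<times> {y i..y i + h i} \<subseteq> {0..w} \<times> {0..H}) \<and>
     (\<forall>i\<in>{1..n}. \<forall>j\<in>{1..n}. i \<noteq> j \<longrightarrow> \<not> collide p h x y i j)"

lemma radix_prod_0: "radix_prod c 0 = 1"
  by (simp add: radix_prod_def)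

lemma radix_prod_Suc: "radix_prod c (Suc k) = radix_prod c k * c (Suc k)"
  by (simp add: radix_prod_def)

lemma radix_prod_pos: "(\<And>k. k \<in> {1..r} \<Longrightarrow> c k > 0) \<Longrightarrow> radix_prod c r > 0"
  by (simp add: radix_prod_def)

lemma radix_prod_dvd: "k \<le> r \<Longrightarrow> radix_prod c k dvd radix_prod c r"
  unfolding radix_prod_def by (intro prod_dvd_prod_subset) auto

lemma height_eq:
  assumes "w > 0" and "k \<in> {1..r}" and "\<And>j. j \<in> {1..r} \<Longrightarrow> b j > 0"
  shows "real (height r b k) = w * real (radix_prod b r) / period w b k"
proof -
  have "radix_prod b k > 0"
    using assms by (intro radix_prod_pos) auto
  then show ?thesis
    using assms(1,2) radix_prod_dvd[of k r b]
    by (simp add: height_def period_def real_of_nat_div)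
qed

lemma mixed_radix_mod:
  "(\<Sum>m=1..r. digit c y m * radix_prod c (m - 1)) = y mod radix_prod c r"
  by (induction r) (simp_all add: radix_prod_0 radix_prod_Suc digit_def mod_mult2_eq)

lemma mixed_radix_decomposition:
  assumes "\<And>m. m \<in> {1..r} \<Longrightarrow> c m > 0" and "y < radix_prod c r"
  shows "y = (\<Sum>m=1..r. digit c y m * radix_prod c (m - 1))"
    and "m \<in> {1..r} \<Longrightarrow> digit c y m < c m"
  using assms mixed_radix_mod[of c y r] by (auto simp: digit_def)

lemma mixed_radix_less:
  assumes "\<And>m. m \<in> {1..r} \<Longrightarrow> d m < c m"
  shows "(\<Sum>m=1..r. d m * radix_prod c (m - 1)) < radix_prod c r"
  using assms
proof (induction r)
  case 0
  then show ?case by (simp add: radix_prod_0)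
next
  case (Suc r)
  have "(\<Sum>m=1..r. d m * radix_prod c (m - 1)) < radix_prod c r"
    using Suc by simp
  moreover have "(d (Suc r) + 1) * radix_prod c r \<le> c (Suc r) * radix_prod c r"
    using Suc.prems[of "Suc r"] by (intro mult_right_mono) auto
  ultimately show ?case
    by (simp add: radix_prod_Suc algebra_simps)
qed

lemma mixed_radix_unique:
  assumes "\<And>m. m \<in> {1..r} \<Longrightarrow> d m < c m"
    and "y = (\<Sum>m=1..r. d m * radix_prod c (m - 1))" and "m \<in> {1..r}"
  shows "d m = digit c y m"
  using assms
proof (induction r arbitrary: y)
  case 0
  then show ?case by simp
next
  case (Suc r)
  define z where "z = (\<Sum>m=1..r. d m * radix_prod c (m - 1))"
  have z: "z < radix_prod c r"
    unfolding z_def using Suc.prems by (intro mixed_radix_less) auto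
  have y: "y = z + d (Suc r) * radix_prod c r"
    using Suc.prems(2) by (simp add: z_def)
  show ?case
  proof (cases "m = Suc r")
    case True
    then show ?thesis
      using z y Suc.prems(1)[of "Suc r"] by (simp add: digit_def)
  next
    case False
    then have m: "m \<in> {1..r}"
      using Suc.prems(3) by auto
    then have dz: "d m = digit c z m"
      using Suc.IH[of z] Suc.prems(1) z_def by auto
    have "radix_prod c m dvd radix_prod c r"
      using m by (intro radix_prod_dvd) auto
    then have "y mod radix_prod c m = z mod radix_prod c m"
      unfolding y by (metis dvd_mult mod_add_right_eq add.right_neutral dvd_imp_mod_0)
    moreover have "digit c t m = t mod radix_prod c m div radix_prod c (m - 1)" for t
    proof (cases m)
      case 0
      then show ?thesis using m by simp
    next
      case (Suc l)
      have "radix_prod c l > 0"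
        using z radix_prod_dvd[of l r c] m Suc by (auto intro: gr0I)
      then show ?thesis
        by (simp add: Suc digit_def radix_prod_Suc mod_mult2_eq)
    qed
    ultimately show ?thesis
      using dz by simp
  qed
qed

end

theory Submission
  imports Defs
begin

text \<open>
  Write \<open>B k\<close> for \<open>radix_prod b k\<close>. Reversing the first \<open>k\<close> digits turns truncation of a number
  modulo \<open>B k\<close> into division, so it maps residue classes to intervals. If \<open>\<nu> i \<le> \<nu> j\<close>, the
  vertical extents of the rectangles of jobs \<open>i\<close> and \<open>j\<close> overlap iff the reversed first \<open>\<nu> i\<close>
  digits of \<open>v i\<close> and \<open>v j\<close> agree, i.e. iff \<open>v i\<close> and \<open>v j\<close> are congruent modulo \<open>B (\<nu> i)\<close>. Then
  some occurrence of job \<open>i\<close> lies in the same window of length \<open>w\<close> as the first occurrence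
  of job \<open>j\<close>, and feasibility of the schedule keeps the two rectangles apart horizontally.
\<close>

text \<open>The part of \<open>flip\<close> that reverses the first \<open>k\<close> digits,
  separated from the digits that \<open>flip\<close> leaves in place.\<close>

definition reverse_digits :: "(nat \<Rightarrow> nat) \<Rightarrow> nat \<Rightarrow> nat \<Rightarrow> nat" where
  "reverse_digits c k y = (\<Sum>m=1..k. digit c y m * (\<Prod>j=m+1..k. c j))"

lemma reverse_digits_0: "reverse_digits c 0 y = 0"
  by (simp add: reverse_digits_def)

text \<open>Horner step: after reversal, digit \<open>k + 1\<close> is the least significant one, so
  it is appended at the low end.\<close>

lemma reverse_digits_Suc:
  "reverse_digits c (Suc k) y = reverse_digits c k y * c (Suc k) + digit c y (Suc k)"
proof -
  have "(\<Sum>m=1..k. digit c y m * (\<Prod>j=m+1..Suc k. c j))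
      = (\<Sum>m=1..k. digit c y m * (\<Prod>j=m+1..k. c j) * c (Suc k))"
    by (intro sum.cong) (auto simp: prod.nat_ivl_Suc')
  then show ?thesis
    by (simp add: reverse_digits_def sum_distrib_right)
qed

lemma reverse_digits_Suc_div:
  "c (Suc k) > 0 \<Longrightarrow> reverse_digits c (Suc k) y div c (Suc k) = reverse_digits c k y"
  by (simp add: reverse_digits_Suc digit_def)

lemma reverse_digits_Suc_mod:
  "reverse_digits c (Suc k) y mod c (Suc k) = digit c y (Suc k)"
  by (simp add: reverse_digits_Suc digit_def)

lemma reverse_digits_less:
  assumes "\<And>j. j \<in> {1..k} \<Longrightarrow> c j > 0"
  shows "reverse_digits c k y < radix_prod c k"
  using assms
proof (induction k)
  case 0
  then show ?case by (simp add: reverse_digits_0 radix_prod_0)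
next
  case (Suc k)
  have "digit c y (Suc k) < c (Suc k)"
    using Suc.prems[of "Suc k"] by (simp add: digit_def)
  moreover have "(reverse_digits c k y + 1) * c (Suc k) \<le> radix_prod c k * c (Suc k)"
    using Suc by (intro mult_right_mono) auto
  ultimately show ?case
    by (simp add: reverse_digits_Suc radix_prod_Suc)
qed

text \<open>The divisor is the product of the bases \<open>k + 1\<close> to \<open>l\<close>, whose
  digits are the lowest ones after reversal. Each induction step strips one of them.\<close>

lemma reverse_digits_div:
  assumes "k \<le> l" and "\<And>j. j \<in> {1..l} \<Longrightarrow> c j > 0"
  shows "reverse_digits c l y div (radix_prod c l div radix_prod c k) = reverse_digits c k y"
  using assms
proof (induction l rule: dec_induct)
  case base
  then have "radix_prod c k > 0" by (intro radix_prod_pos) auto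
  then show ?case by simp
next
  case (step l)
  have "radix_prod c k dvd radix_prod c l"
    using step.hyps by (intro radix_prod_dvd) auto
  then have "radix_prod c (Suc l) div radix_prod c k
      = c (Suc l) * (radix_prod c l div radix_prod c k)"
    by (simp add: radix_prod_Suc mult.commute div_mult_swap)
  then show ?case
    using step by (simp add: div_mult2_eq reverse_digits_Suc_div)
qed

text \<open>Quotient and remainder by the last base recover the shorter reversal and the last digit,
  so the reversal determines all of the first \<open>k\<close> digits.\<close>

lemma reverse_digits_eq_imp_mod_eq:
  assumes "reverse_digits c k y = reverse_digits c k z" and "\<And>j. j \<in> {1..k} \<Longrightarrow> c j > 0"
  shows "y mod radix_prod c k = z mod radix_prod c k"
  using assms
proof (induction k)
  case 0
  then show ?case by (simp add: radix_prod_0)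
next
  case (Suc k)
  have "reverse_digits c k y = reverse_digits c k z"
    using Suc.prems by (metis reverse_digits_Suc_div atLeastAtMost_iff le_refl le_add1 plus_1_eq_Suc)
  then have "y mod radix_prod c k = z mod radix_prod c k"
    using Suc by simp
  moreover have "digit c y (Suc k) = digit c z (Suc k)"
    using Suc.prems(1) by (metis reverse_digits_Suc_mod)
  ultimately show ?case
    by (simp add: radix_prod_Suc mod_mult2_eq digit_def)
qed

text \<open>A number below \<open>radix_prod c k\<close> has only zero digits above position
  \<open>k\<close>.\<close>

lemma flip_eq_reverse_digits:
  assumes "y < radix_prod c k" and "\<And>j. j \<in> {1..r} \<Longrightarrow> c j > 0"
  shows "flip r y k c = reverse_digits c k y"
proof -
  have "digit c y m = 0" if "m \<in> {k+1..r}" for m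
  proof -
    have "radix_prod c (m - 1) > 0"
      using assms(2) that by (intro radix_prod_pos) auto
    moreover have "radix_prod c k dvd radix_prod c (m - 1)"
      using that by (intro radix_prod_dvd) auto
    ultimately have "y < radix_prod c (m - 1)"
      using assms(1) by (meson dvd_imp_le less_le_trans)
    then show ?thesis
      by (simp add: digit_def)
  qed
  then show ?thesis
    by (simp add: flip_def reverse_digits_def)
qed

lemma height_times_radix_prod:
  "k \<le> r \<Longrightarrow> height r b k * radix_prod b k = radix_prod b r"
  by (simp add: height_def radix_prod_dvd)

text \<open>Lets the vertical positions of two rectangles be measured in units of the smaller
  height.\<close>

lemma height_eq_height_times:
  assumes "k \<le> l" and "l \<le> r"
  shows "height r b k = height r b l * (radix_prod b l div radix_prod b k)"
  by (simp only: height_def div_mult_swap[OF radix_prod_dvd[OF assms(1)]]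
      dvd_div_mult_self[OF radix_prod_dvd[OF assms(2)]])

text \<open>In units of \<open>h\<close>, the interval from \<open>c\<close> to \<open>c + 1\<close>
  meets the one from \<open>d * a\<close> to \<open>d * a + d\<close> in more than an endpoint. All
  ends are integers, so the first lies inside the second.\<close>

lemma overlap_imp_div_eq:
  fixes a c d h :: nat
  assumes "h * d * a < h * c + h" and "h * c < h * d * a + h * d"
  shows "c div d = a"
proof -
  have "h * (d * a) < h * Suc c" and "h * c < h * (d * Suc a)"
    using assms by (simp_all add: algebra_simps)
  then have "d * a \<le> c" and "c < d * Suc a"
    by (simp_all only: mult_less_cancel1 less_Suc_eq_le)
  then show ?thesis
    by (intro div_nat_eqI) (simp_all add: mult.commute)
qed

theorem lemma4:
  fixes w :: real and r n :: nat and b :: "nat \<Rightarrow> nat"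
    and p :: "nat \<Rightarrow> real" and \<nu> :: "nat \<Rightarrow> nat"
    and s u x :: "nat \<Rightarrow> real" and v y :: "nat \<Rightarrow> nat"
  assumes "w > 0" and "r \<ge> 1"
    and "\<forall>k\<in>{1..r}. b k > 0"
    and "\<forall>i\<in>{1..n}. 0 < p i \<and> p i \<le> w"
    and "\<forall>i\<in>{1..n}. \<nu> i \<in> {1..r}"
    and "feasible_schedule w r b n p \<nu> s"
    and "\<forall>i\<in>{1..n}. s i = u i + real (v i) * w \<and> 0 \<le> u i \<and> u i < w"
    and "\<forall>i\<in>{1..n}. u i + p i \<le> w"
    and "\<forall>i\<in>{1..n}. x i = u i"
    and "\<forall>i\<in>{1..n}. y i = height r b (\<nu> i) * flip r (v i) (\<nu> i) b"
  shows "feasible_packing w (real (radix_prod b r)) n p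
           (\<lambda>i. real (height r b (\<nu> i))) x (\<lambda>i. real (y i)) \<and>
         (\<forall>i\<in>{1..n}. y i mod height r b (\<nu> i) = 0)"
proof -
  have b_pos: "b j > 0" if "j \<in> {1..r}" for j
    using assms(3) that by blast
  have \<nu>: "\<nu> i \<le> r" if "i \<in> {1..n}" for i
    using assms(5) that by auto
  have v_less: "v i < radix_prod b (\<nu> i)" if "i \<in> {1..n}" for i
  proof -
    have "s i < period w b (\<nu> i)"
      using assms(6) that unfolding feasible_schedule_def periodic_schedule_def by blast
    moreover have "s i = u i + real (v i) * w" "0 \<le> u i"
      using assms(7) that by auto
    ultimately have "real (v i) * w < real (radix_prod b (\<nu> i)) * w"
      by (simp add: period_def)
    then show ?thesis
      using assms(1) by simp
  qed
  have y: "y i = height r b (\<nu> i) * reverse_digits b (\<nu> i) (v i)" if "i \<in> {1..n}" for i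
    using assms(10) that flip_eq_reverse_digits[OF v_less[OF that] b_pos] by simp
  have top: "y i + height r b (\<nu> i) \<le> radix_prod b r" if i: "i \<in> {1..n}" for i
  proof -
    have "reverse_digits b (\<nu> i) (v i) < radix_prod b (\<nu> i)"
      using b_pos \<nu>[OF i] by (intro reverse_digits_less) auto
    \<comment> \<open>Strict inequality of integers leaves a whole unit, which is room for the
      rectangle's own height.\<close>
    then have "height r b (\<nu> i) * Suc (reverse_digits b (\<nu> i) (v i))
        \<le> height r b (\<nu> i) * radix_prod b (\<nu> i)"
      by (intro mult_left_mono) auto
    then show ?thesis
      using y[OF i] \<nu>[OF i] by (simp add: height_times_radix_prod)
  qed
  define C where "C = collide p (\<lambda>i. real (height r b (\<nu> i))) x (\<lambda>i. real (y i))"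
  \<comment> \<open>Collision is symmetric, so ordering the two jobs by period index loses
    nothing.\<close>
  have no_collision: "\<not> C i j"
    if i: "i \<in> {1..n}" and j: "j \<in> {1..n}" and "i \<noteq> j" and le: "\<nu> i \<le> \<nu> j" for i j
  proof
    assume "C i j"
    then have h: "u i < u j + p j" "u j < u i + p i"
      and "y i < y j + height r b (\<nu> j)" "y j < y i + height r b (\<nu> i)"
      using assms(9) i j unfolding C_def collide_def by (auto simp flip: of_nat_add)
    then have "reverse_digits b (\<nu> j) (v j) div (radix_prod b (\<nu> j) div radix_prod b (\<nu> i))
        = reverse_digits b (\<nu> i) (v i)"
      using y[OF i] y[OF j] height_eq_height_times[OF le \<nu>[OF j], of b]
      by (intro overlap_imp_div_eq[where h = "height r b (\<nu> j)"]) simp_all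
    moreover have "reverse_digits b (\<nu> j) (v j) div (radix_prod b (\<nu> j) div radix_prod b (\<nu> i))
        = reverse_digits b (\<nu> i) (v j)"
      using le b_pos \<nu>[OF j] by (intro reverse_digits_div) auto
    ultimately have "v j mod radix_prod b (\<nu> i) = v i mod radix_prod b (\<nu> i)"
      using b_pos \<nu>[OF i] by (intro reverse_digits_eq_imp_mod_eq) auto
    then have mod: "v j mod radix_prod b (\<nu> i) = v i"
      using v_less[OF i] by simp
    \<comment> \<open>Occurrence \<open>k\<close> of job \<open>i\<close> falls in window number
      \<open>v j\<close>, that of the first occurrence of job \<open>j\<close>.\<close>
    define k where "k = v j div radix_prod b (\<nu> i)"
    have vj: "v j = v i + k * radix_prod b (\<nu> i)"
      using mod by (metis k_def mod_div_mult_eq)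
    \<comment> \<open>It remains to see that \<open>k\<close> is among the occurrences that
      feasibility covers.\<close>
    have "radix_prod b (\<nu> j) \<le> radix_prod b r"
      using radix_prod_dvd[OF \<nu>[OF j]] radix_prod_pos[of r b] b_pos by (intro dvd_imp_le) auto
    then have "v j < height r b (\<nu> i) * radix_prod b (\<nu> i)"
      using v_less[OF j] \<nu>[OF i] by (simp add: height_times_radix_prod)
    then have k: "k < height r b (\<nu> i)"
      unfolding k_def by (rule less_mult_imp_div_less)
    have "radix_prod b r > 0"
      using b_pos by (intro radix_prod_pos) auto
    then have "0 < height r b (\<nu> j)"
      using height_times_radix_prod[OF \<nu>[OF j], of b] by (auto intro: gr0I)
    then have "s i + real k * period w b (\<nu> i) + p i \<le> s j + real 0 * period w b (\<nu> j) \<or>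
        s j + real 0 * period w b (\<nu> j) + p j \<le> s i + real k * period w b (\<nu> i)"
      using assms(6) i j \<open>i \<noteq> j\<close> k unfolding feasible_schedule_def by blast
    moreover have "s i + real k * period w b (\<nu> i) = u i + real (v j) * w"
      using assms(7) i vj by (simp add: period_def algebra_simps)
    \<comment> \<open>With the common offset \<open>v j * w\<close> cancelled, either disjunct
      separates the horizontal extents, contrary to \<open>h\<close>.\<close>
    ultimately show False
      using assms(7) j h by auto
  qed
  have "C i j \<longleftrightarrow> C j i" for i j
    unfolding C_def collide_def by auto
  then have "\<forall>i\<in>{1..n}. \<forall>j\<in>{1..n}. i \<noteq> j \<longrightarrow> \<not> C i j"
    using no_collision by (metis linear)
  moreover have "{x i..x i + p i} \<times> {real (y i)..real (y i) + real (height r b (\<nu> i))}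
      \<subseteq> {0..w} \<times> {0..real (radix_prod b r)}" if i: "i \<in> {1..n}" for i
  proof -
    have "0 \<le> x i" "x i + p i \<le> w"
      using assms(7-9) i by auto
    moreover have "real (y i) + real (height r b (\<nu> i)) \<le> real (radix_prod b r)"
      using top[OF i] by linarith
    ultimately show ?thesis
      by (intro Sigma_mono) auto
  qed
  moreover have "\<forall>i\<in>{1..n}. y i mod height r b (\<nu> i) = 0"
    using y by simp
  ultimately show ?thesis
    unfolding feasible_packing_def C_def by blast
qed

end
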